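(* There exists a positive constant $C_2$ such that for every real $q > 1$ which is not of the form $r^{1/m}$ for any rational $r > 1$ and any positive integer $m$, we have $a(\mathcal{G}^{(n)}) \geq C_2 n$ for every geometric progression $\mathcal{G} = \mathcal{G}(u,q)$ (with $u > 0$) and every integer $n \geq 1$. In particular, one can take $C_2 = 1/6$.
   Context: For real $v \geq 0$ and $d > 0$, $\mathcal{A}(v,d) := \{v, v+d, v+2d, \ldots\}$ is the arithmetic progression with first term $v$ and common difference $d$. For real $u > 0$ and $q > 1$, $\mathcal{G}(u,q) := \{u, uq, uq^2, \ldots\}$ is the geometric progression with first term $u$ and ratio $q$. For a positive integer $n$, $\mathcal{G}^{(n)}$ denotes the set of the first $n$ terms of $\mathcal{G}$. For a finite set $\mathcal{S}$ of nonnegative real numbers, $a(\mathcal{S})$ denotes the least positive integer $h$ such that there exist $h$ arithmetic progressions $\mathcal{A}_1, \ldots, \mathcal{A}_h$ (each of the form $\mathcal{A}(v,d)$ with $v \geq 0$, $d>0$) with $\mathcal{S} \subseteq \bigcup_{i=1}^h \mathcal{A}_i$. *)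

theory Defs
  imports Complex_Main
begin

definition arith_prog :: "real \<Rightarrow> real \<Rightarrow> real set" where
  "arith_prog v d = {v + real k * d | k. True}"

definition geom_prog_upto :: "nat \<Rightarrow> real \<Rightarrow> real \<Rightarrow> real set" where
  "geom_prog_upto n u q = {u * q ^ k | k. k < n}"

definition covered_by_aps :: "real set \<Rightarrow> nat \<Rightarrow> bool" where
  "covered_by_aps S h \<longleftrightarrow>
     (\<exists>v d :: nat \<Rightarrow> real. (\<forall>i<h. v i \<ge> 0 \<and> d i > 0) \<and> S \<subseteq> (\<Union>i<h. arith_prog (v i) (d i)))"

text \<open>Only meaningful for finite sets of nonnegative reals, where a suitable \<open>h\<close> exists
  (one progression per element); see \<open>ap_cover_number_witness\<close>.\<close>

definition ap_cover_number :: "real set \<Rightarrow> nat" where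
  "ap_cover_number S = (LEAST h. h > 0 \<and> covered_by_aps S h)"

lemma ap_cover_number_witness:
  assumes "finite S" and "\<And>x. x \<in> S \<Longrightarrow> x \<ge> 0"
  shows "ap_cover_number S > 0 \<and> covered_by_aps S (ap_cover_number S)"
proof -
  obtain n and f :: "nat \<Rightarrow> real" where f: "S = f ` {i. i < n}"
    using finite_imp_nat_seg_image_inj_on[OF assms(1)] by blast
  define v where "v = (\<lambda>i. if i < n then f i else 0)"
  have "\<forall>i. v i \<ge> 0"
    using assms(2) f by (auto simp: v_def)
  have self: "v i \<in> arith_prog (v i) 1" for i
  proof -
    have "v i = v i + real 0 * 1" by simp
    thus ?thesis unfolding arith_prog_def by blast
  qed
  have "S \<subseteq> (\<Union>i<Suc n. arith_prog (v i) 1)"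
  proof
    fix x assume "x \<in> S"
    then obtain i where i: "i < n" "x = f i" using f by auto
    hence "x = v i" by (simp add: v_def)
    thus "x \<in> (\<Union>i<Suc n. arith_prog (v i) 1)"
      using self[of i] i(1) by (intro UN_I[of i]) auto
  qed
  with \<open>\<forall>i. v i \<ge> 0\<close>
  have "(\<forall>i<Suc n. v i \<ge> 0 \<and> (1::real) > 0) \<and> S \<subseteq> (\<Union>i<Suc n. arith_prog (v i) 1)"
    by simp
  hence "covered_by_aps S (Suc n)"
    unfolding covered_by_aps_def by (intro exI[where x = v] exI[where x = "\<lambda>_. 1"])
  hence "Suc n > 0 \<and> covered_by_aps S (Suc n)" by simp
  thus ?thesis
    unfolding ap_cover_number_def by (rule LeastI)
qed

definition is_root_of_rational :: "real \<Rightarrow> bool" where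
  "is_root_of_rational q \<longleftrightarrow>
     (\<exists>(r::rat) (m::nat). r > 1 \<and> m > 0 \<and> q = of_rat r powr (1 / real m))"

end

theory Submission
  imports Defs "HOL-Computational_Algebra.Fundamental_Theorem_Algebra"
begin

text \<open>
  Every arithmetic progression meets \<open>\<G>(u,q)\<close> in at most three terms, so that even
  \<open>a(\<G>\<^bsup>(n)\<^esup>) \<ge> n/3\<close>. Indeed, if the terms with exponents \<open>k\<^sub>0 < k\<^sub>1 < \<dots>\<close>
  lie in one progression, then the ratios of the numbers \<open>q ^ (k\<^sub>i - k\<^sub>0) - 1\<close> are rational.
  With three terms this makes \<open>q\<close> algebraic, and every conjugate \<open>z\<close> of \<open>q\<close> satisfies
  \<open>z ^ l = 1 + t * (q ^ l - 1)\<close> for all differences \<open>l = k\<^sub>i - k\<^sub>0\<close>, with one fixed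
  \<open>t \<noteq> 0\<close>. Not all conjugates have modulus \<open>q\<close>, since otherwise the norm of \<open>q\<close> shows that
  a power of \<open>q\<close> is rational. For a conjugate with \<open>\<bar>z\<bar> \<noteq> q\<close> the squared moduli give
  \<open>\<bar>z\<bar> ^ (2 * l) = \<bar>t\<bar>\<^sup>2 * q ^ (2 * l) + B * q ^ l + D\<close>, a nontrivial real exponential
  equation with four terms, which has at most three real solutions \<open>l\<close> by Rolle's theorem.
\<close>

section \<open>Zeros of real exponential sums\<close>

text \<open>Induction on the maximum: Rolle between the old and the new maximum of \<open>Z\<close>
  gives a zero of \<open>f'\<close>. The clause \<open>\<exists>z\<in>Z. w < z\<close> keeps all
  earlier zeros below the old maximum, so the new one is distinct from them.\<close>

lemma Rolle_card:
  fixes f f' :: "real \<Rightarrow> real"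
  assumes f: "\<And>x. (f has_real_derivative f' x) (at x)"
    and "finite Z" "\<forall>z\<in>Z. f z = 0"
  shows "\<exists>W. finite W \<and> (\<forall>w\<in>W. f' w = 0 \<and> (\<exists>z\<in>Z. w < z)) \<and> card Z \<le> Suc (card W)"
  using assms(2,3)
proof (induction Z rule: finite_linorder_max_induct)
  case empty
  show ?case by (intro exI[of _ "{}"]) simp
next
  case (insert b A)
  then obtain W where W: "finite W" "\<forall>w\<in>W. f' w = 0 \<and> (\<exists>z\<in>A. w < z)" "card A \<le> Suc (card W)"
    by auto
  show ?case
  proof (cases "A = {}")
    case True
    then show ?thesis by (intro exI[of _ "{}"]) simp
  next
    case False
    define a where "a = Max A"
    have a: "a \<in> A" "\<And>x. x \<in> A \<Longrightarrow> x \<le> a"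
      using False insert.hyps by (auto simp: a_def)
    have "\<exists>w. a < w \<and> w < b \<and> (\<lambda>v. f' w * v) = (\<lambda>v. 0)"
    proof (rule Rolle_deriv)
      show "a < b" "f a = f b" using a insert by auto
      show "continuous_on {a..b} f"
        using f by (meson DERIV_continuous continuous_at_imp_continuous_on)
      show "(f has_derivative (\<lambda>v. f' x * v)) (at x)" for x
        using f by (simp add: has_field_derivative_def)
    qed
    then obtain w where w: "a < w" "w < b" "f' w = 0"
      by (metis mult.right_neutral)
    have "w \<notin> W" using W(2) a(2) w(1) by force
    then show ?thesis
      using W w a insert.hyps by (intro exI[of _ "insert w W"]) auto
  qed
qed

text \<open>Multiplying by \<open>exp (- l i * x)\<close> makes summand \<open>i\<close> constant,
  differentiation removes it, and Rolle costs at most one zero. Since \<open>l m\<close> differs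
  from every other frequency, the coefficient of \<open>m\<close> stays nonzero throughout; the
  other frequencies may coincide.\<close>

lemma card_zeros_exp_sum_less:
  fixes c l :: "'a \<Rightarrow> real" and Z :: "real set"
  assumes "finite I" "m \<in> I" "c m \<noteq> 0" "\<And>i. i \<in> I \<Longrightarrow> i \<noteq> m \<Longrightarrow> l i \<noteq> l m"
    and "finite Z" "\<And>x. x \<in> Z \<Longrightarrow> (\<Sum>i\<in>I. c i * exp (l i * x)) = 0"
  shows "card Z < card I"
  using assms
proof (induction "card I" arbitrary: I c l Z rule: less_induct)
  case less
  show ?case
  proof (cases "I = {m}")
    case True
    then have "x \<notin> Z" for x using less.prems(3) less.prems(6)[of x] by auto
    then have "Z = {}" by blast
    then show ?thesis using True by simp
  next
    case False
    then obtain i where i: "i \<in> I" "i \<noteq> m" using \<open>m \<in> I\<close> by blast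
    define g where "g = (\<lambda>x. \<Sum>j\<in>I. c j * exp ((l j - l i) * x))"
    define g' where "g' = (\<lambda>x. \<Sum>j\<in>I. c j * (l j - l i) * exp ((l j - l i) * x))"
    have "g x = exp (- l i * x) * (\<Sum>j\<in>I. c j * exp (l j * x))" for x
      unfolding g_def sum_distrib_left
    proof (rule sum.cong[OF refl])
      fix j
      have "exp ((l j - l i) * x) = exp (- l i * x) * exp (l j * x)"
        by (simp add: mult_exp_exp left_diff_distrib)
      then show "c j * exp ((l j - l i) * x) = exp (- l i * x) * (c j * exp (l j * x))"
        by simp
    qed
    then have "\<forall>z\<in>Z. g z = 0" using less.prems(6) by simp
    moreover have "(g has_real_derivative g' x) (at x)" for x
      unfolding g_def g'_def
      by (rule DERIV_sum) (auto intro!: derivative_eq_intros)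
    ultimately obtain W where W: "finite W" "\<forall>w\<in>W. g' w = 0" "card Z \<le> Suc (card W)"
      using Rolle_card[of g g' Z] \<open>finite Z\<close> by meson
    \<comment> \<open>Summand \<open>i\<close> of \<open>g'\<close> carries the factor
      \<open>l i - l i\<close>, so dropping it leaves the value of the sum unchanged.\<close>
    have "card W < card (I - {i})"
    proof (rule less.hyps)
      show "card (I - {i}) < card I" using i(1) \<open>finite I\<close> by (rule card_Diff1_less[rotated])
      show "c m * (l m - l i) \<noteq> 0" using less.prems(3) less.prems(4)[OF i] by simp
      show "l j - l i \<noteq> l m - l i" if "j \<in> I - {i}" "j \<noteq> m" for j
        using that less.prems(4)[of j] by simp
      show "(\<Sum>j\<in>I - {i}. c j * (l j - l i) * exp ((l j - l i) * x)) = 0" if "x \<in> W" for x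
        using W(2) that sum.remove[OF \<open>finite I\<close> i(1), of "\<lambda>j. c j * (l j - l i) * exp ((l j - l i) * x)"]
        by (simp add: g'_def)
    qed (use i \<open>finite I\<close> \<open>m \<in> I\<close> W in auto)
    then show ?thesis using W(3) i \<open>finite I\<close> by simp
  qed
qed

text \<open>The isolated frequency is \<open>2 * ln q\<close>, at index 1 with coefficient
  \<open>- A\<close>. The frequency \<open>2 * ln r\<close> is allowed to equal \<open>ln q\<close>
  or 0.\<close>

lemma card_le_3_of_power_equation:
  fixes r q A B D :: real and K :: "nat set"
  assumes "r > 0" "q > 1" "r \<noteq> q" "A \<noteq> 0" "finite K"
    and eq: "\<And>k. k \<in> K \<Longrightarrow> r ^ (2 * k) = A * q ^ (2 * k) + B * q ^ k + D"
  shows "card K \<le> 3"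
proof -
  define c where "c = (\<lambda>i. [1, - A, - B, - D] ! i)"
  define l where "l = (\<lambda>i. [2 * ln r, 2 * ln q, ln q, 0] ! i)"
  have *: "exp (2 * (ln x * real k)) = x ^ (2 * k)" "exp (ln x * real k) = x ^ k"
    if "x > 0" for x k
    using exp_of_nat_mult[of "2 * k" "ln x"] exp_of_nat_mult[of k "ln x"] that
    by (simp_all add: algebra_simps)
  have "card (real ` K) < card {..<4::nat}"
  proof (rule card_zeros_exp_sum_less[where m = 1 and c = c and l = l])
    show "l i \<noteq> l 1" if "i \<in> {..<4}" "i \<noteq> 1" for i
    proof -
      have "i = 0 \<or> i = 2 \<or> i = 3" using that by auto
      then show ?thesis using assms by (auto simp: l_def)
    qed
    show "(\<Sum>i<4. c i * exp (l i * x)) = 0" if "x \<in> real ` K" for x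
    proof -
      obtain k where k: "k \<in> K" "x = real k" using \<open>x \<in> real ` K\<close> by auto
      have "{..<4::nat} = {0, 1, 2, 3}" by auto
      then show ?thesis using eq[OF k(1)] assms(1,2)
        by (simp add: c_def l_def k(2) * mult.assoc del: power_mult)
    qed
  qed (use assms in \<open>auto simp: c_def\<close>)
  then show ?thesis by (simp add: card_image)
qed

section \<open>Conjugates of algebraic numbers\<close>

definition rat_eval :: "complex \<Rightarrow> rat poly \<Rightarrow> complex" where
  "rat_eval x p = poly (map_poly of_rat p) x"

lemma rat_eval_pCons [simp]: "rat_eval x (pCons a p) = of_rat a + x * rat_eval x p"
  by (simp add: rat_eval_def map_poly_pCons)

lemma rat_eval_0 [simp]: "rat_eval x 0 = 0"
  by (simp add: rat_eval_def)

lemma rat_eval_1 [simp]: "rat_eval x 1 = 1"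
  by (simp add: one_pCons)

lemma rat_eval_add [simp]: "rat_eval x (p + q) = rat_eval x p + rat_eval x q"
  by (induction p q rule: poly_induct2) (simp_all add: of_rat_add algebra_simps)

lemma rat_eval_smult [simp]: "rat_eval x (smult a p) = of_rat a * rat_eval x p"
  by (induction p) (simp_all add: of_rat_mult algebra_simps)

lemma rat_eval_diff [simp]: "rat_eval x (p - q) = rat_eval x p - rat_eval x q"
  using rat_eval_add[of x "p - q" q] by simp

lemma rat_eval_mult [simp]: "rat_eval x (p * q) = rat_eval x p * rat_eval x q"
  by (induction p) (simp_all add: algebra_simps)

lemma rat_eval_monom [simp]: "rat_eval x (monom a n) = of_rat a * x ^ n"
  by (induction n) (simp_all add: monom_0 monom_Suc)

text \<open>Take \<open>f\<close> of least degree among the nonzero polynomials vanishing at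
  \<open>x\<close>: the remainder modulo \<open>f\<close> of any polynomial vanishing at
  \<open>x\<close> vanishes there too, hence is zero.\<close>

lemma exists_minimal_rat_poly:
  assumes "p \<noteq> 0" "rat_eval x p = 0"
  shows "\<exists>f. f \<noteq> 0 \<and> (\<forall>p. rat_eval x p = 0 \<longleftrightarrow> f dvd p)"
proof -
  define P where "P = (\<lambda>f. f \<noteq> 0 \<and> rat_eval x f = 0)"
  obtain f where f: "P f" "\<And>g. P g \<Longrightarrow> degree f \<le> degree g"
    using exists_least_iff[of "\<lambda>n. \<exists>g. P g \<and> degree g = n"] assms
    unfolding P_def by (metis linorder_le_less_linear)
  have "f dvd p" if "rat_eval x p = 0" for p
  proof -
    have "rat_eval x (p mod f) = rat_eval x p - rat_eval x (p div f) * rat_eval x f"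
      by (simp flip: rat_eval_mult rat_eval_diff add: minus_div_mult_eq_mod)
    then have "rat_eval x (p mod f) = 0" using that f(1) by (simp add: P_def)
    then have "p mod f = 0"
      using f degree_mod_less'[of f p] unfolding P_def by (metis not_le)
    then show ?thesis by (simp add: dvd_eq_mod_eq_0)
  qed
  then show ?thesis using f(1) unfolding P_def dvd_def by auto
qed

text \<open>Conjugates satisfy the same rational relations. The minimal polynomial \<open>g\<close>
  of \<open>z\<close> divides \<open>f\<close>; the cofactor \<open>h\<close> cannot vanish at
  \<open>x\<close>, as then \<open>f dvd h\<close> would make \<open>g\<close> a unit. So
  \<open>g\<close> vanishes at \<open>x\<close>.\<close>

lemma root_of_minimal_rat_poly:
  assumes f: "f \<noteq> 0" "\<And>p. rat_eval x p = 0 \<longleftrightarrow> f dvd p"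
    and z: "rat_eval z f = 0"
  shows "rat_eval z p = 0 \<longleftrightarrow> rat_eval x p = 0"
proof
  show "rat_eval z p = 0" if "rat_eval x p = 0"
    using that z f(2) by (auto simp: dvd_def)
  assume p: "rat_eval z p = 0"
  obtain g where g: "g \<noteq> 0" "\<And>p. rat_eval z p = 0 \<longleftrightarrow> g dvd p"
    using exists_minimal_rat_poly[OF f(1) z] by blast
  obtain h where h: "f = g * h" using g(2) z by (auto simp: dvd_def)
  have "rat_eval x g * rat_eval x h = 0"
    using f(2)[of f] h by simp
  moreover have "rat_eval x h \<noteq> 0"
  proof
    assume "rat_eval x h = 0"
    then obtain e where "h = g * h * e" using f(2) h by (auto simp: dvd_def)
    moreover have "h \<noteq> 0" using f(1) h by auto
    ultimately have "1 = g * e" by (metis mult.assoc mult.commute mult_cancel_left1)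
    then have "g dvd 1" by (rule dvdI)
    then show False using g(2)[of 1] by simp
  qed
  ultimately have "rat_eval x g = 0" by simp
  then show "rat_eval x p = 0" using g(2)[of p] p by (auto simp: dvd_def)
qed

text \<open>Up to sign, the constant coefficient is the leading one times the product of the
  roots.\<close>

lemma norm_poly_0_of_roots_on_circle:
  fixes p :: "complex poly"
  assumes "\<And>z. poly p z = 0 \<Longrightarrow> norm z = r"
  shows "norm (poly p 0) = norm (lead_coeff p) * r ^ degree p"
proof (cases "p = 0")
  case False
  obtain root where root: "smult (lead_coeff p) (\<Prod>i<degree p. [:-root i, 1:]) = p"
    by (rule complex_poly_decompose')
  have ev: "poly p z = lead_coeff p * (\<Prod>i<degree p. z - root i)" for z
    by (subst root[symmetric]) (simp add: poly_prod)
  have "norm (root i) = r" if "i < degree p" for i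
    using that by (intro assms) (auto simp: ev)
  then show ?thesis by (simp add: ev norm_mult prod_norm[symmetric])
qed auto

lemma of_real_of_rat_complex [simp]: "complex_of_real (of_rat a) = of_rat a"
  by (cases a) (simp add: of_rat_rat)

lemma norm_of_rat_complex: "norm (of_rat a :: complex) = of_rat \<bar>a\<bar>"
  by (metis abs_of_rat norm_of_real of_real_of_rat_complex)

lemma exists_conjugate_norm_neq:
  fixes q :: real
  assumes q: "q > 0" and irrat: "\<And>m. m > 0 \<Longrightarrow> q ^ m \<notin> \<rat>"
    and "p \<noteq> 0" "rat_eval (of_real q) p = 0"
  shows "\<exists>z. norm z \<noteq> q \<and> (\<forall>p. rat_eval z p = 0 \<longleftrightarrow> rat_eval (of_real q) p = 0)"
proof -
  obtain f where f: "f \<noteq> 0" "\<And>p. rat_eval (of_real q) p = 0 \<longleftrightarrow> f dvd p"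
    using exists_minimal_rat_poly[OF assms(3,4)] by blast
  define F :: "complex poly" where "F = map_poly of_rat f"
  have coeff: "coeff F i = of_rat (coeff f i)" for i
    by (simp add: F_def coeff_map_poly)
  have degree: "degree F = degree f"
    by (simp add: F_def degree_map_poly)
  \<comment> \<open>\<open>irrat\<close> speaks of positive exponents only, and it will be applied
    to \<open>degree f\<close>.\<close>
  have "degree f \<noteq> 0"
  proof
    assume "degree f = 0"
    then obtain a where "f = [:a:]" by (rule degree_eq_zeroE)
    then show False using f(1) f(2)[of f] by simp
  qed
  have "\<exists>z. poly F z = 0 \<and> norm z \<noteq> q"
  proof (rule ccontr)
    assume "\<not> ?thesis"
    then have "norm (poly F 0) = norm (lead_coeff F) * q ^ degree F"
      by (intro norm_poly_0_of_roots_on_circle) auto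
    then have "of_rat \<bar>coeff f 0\<bar> = of_rat \<bar>lead_coeff f\<bar> * q ^ degree f"
      by (simp add: poly_0_coeff_0 coeff degree norm_of_rat_complex)
    then have "q ^ degree f = of_rat (\<bar>coeff f 0\<bar> / \<bar>lead_coeff f\<bar>)"
      using f(1) by (simp add: of_rat_divide field_simps)
    then show False using irrat \<open>degree f \<noteq> 0\<close> by (metis Rats_of_rat gr0I)
  qed
  then show ?thesis
    using root_of_minimal_rat_poly[OF f] by (auto simp: rat_eval_def F_def)
qed

section \<open>Terms of a geometric progression in an arithmetic progression\<close>

lemma power_notin_Rats:
  assumes "q > 1" "\<not> is_root_of_rational q" "m > 0"
  shows "q ^ m \<notin> \<rat>"
proof
  assume "q ^ m \<in> \<rat>"
  then obtain r where r: "q ^ m = of_rat r" by (auto simp: Rats_def)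
  have "1 < (of_rat r :: real)" using assms one_less_power[of q m] by (simp flip: r)
  then have "r > 1" by simp
  moreover have "q = of_rat r powr (1 / real m)"
    using assms by (simp flip: r add: powr_realpow[symmetric] powr_powr)
  ultimately show False using assms unfolding is_root_of_rational_def by blast
qed

text \<open>\<open>L\<close> stands for the exponent differences \<open>k - k0\<close>, and
  \<open>\<gamma>\<close> is a common unit in which every \<open>q ^ l - 1\<close> has a rational
  measure.\<close>

lemma card_le_3_of_rational_ratios:
  fixes q \<gamma> :: real and L :: "nat set" and s :: "nat \<Rightarrow> rat"
  assumes q: "q > 1" "\<not> is_root_of_rational q"
    and L: "finite L" "0 \<in> L" and s: "\<And>l. l \<in> L \<Longrightarrow> q ^ l - 1 = of_rat (s l) * \<gamma>"
  shows "card L \<le> 3"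
proof (cases "card L \<le> 2")
  case False
  then have "\<exists>j. j \<in> L - {0}"
    using L by (metis card.empty card.insert_remove equals0I finite.emptyI insert_Diff_single
        insert_absorb le_numeral_extra(3) less_eq_Suc_le not_less_eq_eq numeral_2_eq_2 le_SucI)
  then obtain j where j: "j \<in> L" "j > 0" by auto
  have "\<not> L \<subseteq> {0, j}"
    using False card_mono[of "{0, j}" L] j by (auto simp: card_insert_if)
  then obtain k where k: "k \<in> L" "k > 0" "k \<noteq> j" by auto
  have neq1: "q ^ l \<noteq> 1" if "l > 0" for l
    using one_less_power[OF q(1) that] by simp
  have sj: "s j \<noteq> 0" using s[OF j(1)] neq1[OF j(2)] by auto
  \<comment> \<open>\<open>T l\<close> is the rational relation left after eliminating
    \<open>\<gamma>\<close> between the exponents \<open>j\<close> and \<open>l\<close>. As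
    \<open>k\<close> is neither 0 nor \<open>j\<close>, nothing cancels the leading
    \<open>s j\<close> in \<open>T k\<close>, so \<open>q\<close> is algebraic.\<close>
  define T where "T = (\<lambda>l. smult (s j) (monom 1 l - 1) - smult (s l) (monom 1 j - 1))"
  have T: "rat_eval x (T l) = of_rat (s j) * (x ^ l - 1) - of_rat (s l) * (x ^ j - 1)" for x l
    by (simp add: T_def)
  have T0: "rat_eval (of_real q) (T l) = 0" if "l \<in> L" for l
  proof -
    have "of_rat (s j) * (q ^ l - 1) = of_rat (s l) * (q ^ j - 1)"
      using s j that by simp
    then have "complex_of_real (of_rat (s j) * (q ^ l - 1)) = of_real (of_rat (s l) * (q ^ j - 1))"
      by simp
    then show ?thesis by (simp add: T)
  qed
  have "coeff (T k) k = s j" using k j by (simp add: T_def)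
  then have "T k \<noteq> 0" using sj by auto
  then obtain z where z: "norm z \<noteq> q"
      "\<And>p. rat_eval z p = 0 \<longleftrightarrow> rat_eval (of_real q) p = 0"
    using exists_conjugate_norm_neq[OF _ power_notin_Rats[OF q] _ T0[OF k(1)]] q by force
  \<comment> \<open>The relations X = 0 and X^j = 1 fail at \<open>q\<close>, hence also at its
    conjugate \<open>z\<close>.\<close>
  have "z \<noteq> 0" using z(2)[of "monom 1 1"] q by simp
  have "z ^ j \<noteq> 1"
    using z(2)[of "monom 1 j - 1"] neq1[OF j(2)] by (simp flip: of_real_power)
  define t where "t = (z ^ j - 1) / (of_real (q ^ j) - 1)"
  have "t \<noteq> 0" using \<open>z ^ j \<noteq> 1\<close> neq1[OF j(2)] by (simp add: t_def flip: of_real_power)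
  have zl: "z ^ l = 1 + t * (of_real q ^ l - 1)" if "l \<in> L" for l
  proof -
    have qj: "complex_of_real q ^ j - 1 \<noteq> 0"
      using neq1[OF j(2)] by (simp flip: of_real_power)
    have zs: "of_rat (s j) * (z ^ l - 1) = of_rat (s l) * (z ^ j - 1)"
      using z(2)[of "T l"] T0[OF that] T[of z l] by simp
    have qs: "of_rat (s j) * (complex_of_real q ^ l - 1) = of_rat (s l) * (of_real q ^ j - 1)"
      using T0[OF that] T[of "of_real q" l] by simp
    \<comment> \<open>The relations \<open>zs\<close> and \<open>qs\<close> are combined crosswise,
      because \<open>s l\<close> is 0 for \<open>l = 0\<close> and cannot be divided by.\<close>
    have "of_rat (s j) * ((z ^ l - 1) * (complex_of_real q ^ j - 1)) =
        (z ^ j - 1) * (of_rat (s l) * (of_real q ^ j - 1))"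
      by (simp only: zs mult.assoc[symmetric]) (simp only: mult_ac)
    also have "\<dots> = of_rat (s j) * ((z ^ j - 1) * (of_real q ^ l - 1))"
      by (simp only: qs[symmetric] mult.left_commute)
    finally have "of_rat (s j) * ((z ^ l - 1) * (complex_of_real q ^ j - 1)) =
        of_rat (s j) * ((z ^ j - 1) * (of_real q ^ l - 1))" .
    then have "(z ^ l - 1) * (complex_of_real q ^ j - 1) = (z ^ j - 1) * (of_real q ^ l - 1)"
      using sj by simp
    then show ?thesis using qj by (simp add: t_def field_simps)
  qed
  show ?thesis
  proof (rule card_le_3_of_power_equation)
    show "norm z > 0" "norm z \<noteq> q" "(norm t)\<^sup>2 \<noteq> 0"
      using \<open>z \<noteq> 0\<close> z(1) \<open>t \<noteq> 0\<close> by auto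
    \<comment> \<open>This is the squared modulus of (1 - t) + t q^l; the cross term is twice the
      real part of t times the conjugate of 1 - t.\<close>
    show "norm z ^ (2 * l) = (norm t)\<^sup>2 * q ^ (2 * l)
        + (2 * Re t - 2 * (norm t)\<^sup>2) * q ^ l + (norm (1 - t))\<^sup>2" if "l \<in> L" for l
    proof -
      have "norm z ^ (2 * l) = (norm (1 + t * of_real (q ^ l - 1)))\<^sup>2"
        using zl[OF that] by (simp add: mult.commute[of 2 l] power_mult flip: norm_power)
      also have "\<dots> = (norm t)\<^sup>2 * (q ^ l)\<^sup>2
        + (2 * Re t - 2 * (norm t)\<^sup>2) * q ^ l + (norm (1 - t))\<^sup>2"
        by (simp add: cmod_power2 del: of_real_diff of_real_power) algebra
      finally show ?thesis by (simp add: mult.commute[of 2 l] power_mult)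
    qed
  qed (use q L in auto)
qed auto

text \<open>Differences from the term with least exponent \<open>k0\<close> are integer multiples of
  \<open>d\<close>; dividing by that term gives the unit \<open>d / (u * q ^ k0)\<close>.\<close>

lemma card_geom_terms_in_arith_prog_le_3:
  assumes q: "q > 1" "\<not> is_root_of_rational q" and "u > 0"
    and K: "finite K" "\<And>k. k \<in> K \<Longrightarrow> u * q ^ k \<in> arith_prog v d"
  shows "card K \<le> 3"
proof (cases "K = {}")
  case False
  define k0 where "k0 = Min K"
  have k0: "k0 \<in> K" "\<And>k. k \<in> K \<Longrightarrow> k0 \<le> k" using K False by (auto simp: k0_def)
  obtain m :: "nat \<Rightarrow> nat" where m: "\<And>k. k \<in> K \<Longrightarrow> u * q ^ k = v + real (m k) * d"
    using K(2) unfolding arith_prog_def by simp metis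
  define L where "L = (\<lambda>k. k - k0) ` K"
  have "card L \<le> 3"
  proof (rule card_le_3_of_rational_ratios[OF q])
    show "finite L" "0 \<in> L" using K k0 by (auto simp: L_def)
    fix l assume "l \<in> L"
    then have l: "l + k0 \<in> K" using k0 by (auto simp: L_def)
    have "u * q ^ k0 * (q ^ l - 1) = u * q ^ (l + k0) - u * q ^ k0"
      by (simp add: algebra_simps power_add)
    also have "\<dots> = (real (m (l + k0)) - real (m k0)) * d"
      using m[OF l] m[OF k0(1)] by (simp add: algebra_simps)
    finally show "q ^ l - 1 = of_rat (of_nat (m (l + k0)) - of_nat (m k0)) * (d / (u * q ^ k0))"
      using \<open>u > 0\<close> q by (simp add: of_rat_diff field_simps)
  qed
  moreover have "inj_on (\<lambda>k. k - k0) K"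
    using k0(2) by (auto simp: inj_on_def) (metis le_add_diff_inverse)
  ultimately show ?thesis by (simp add: L_def card_image)
qed auto

text \<open>Each progression of an optimal cover accounts for at most three of the \<open>n\<close>
  exponents.\<close>

lemma ap_cover_number_geom_prog_ge:
  assumes q: "q > 1" "\<not> is_root_of_rational q" and "u > 0"
  shows "n \<le> 3 * ap_cover_number (geom_prog_upto n u q)"
proof -
  define h where "h = ap_cover_number (geom_prog_upto n u q)"
  have "geom_prog_upto n u q = (\<lambda>k. u * q ^ k) ` {..<n}"
    by (auto simp: geom_prog_upto_def)
  then have "covered_by_aps (geom_prog_upto n u q) h"
    unfolding h_def using q \<open>u > 0\<close> by (intro conjunct2[OF ap_cover_number_witness]) auto
  then obtain v d where cover: "geom_prog_upto n u q \<subseteq> (\<Union>i<h. arith_prog (v i) (d i))"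
    unfolding covered_by_aps_def by blast
  define K where "K = (\<lambda>i. {k. k < n \<and> u * q ^ k \<in> arith_prog (v i) (d i)})"
  have "{..<n} \<subseteq> (\<Union>i<h. K i)"
    using cover by (fastforce simp: K_def geom_prog_upto_def)
  then have "card {..<n} \<le> card (\<Union>i<h. K i)"
    by (rule card_mono[rotated]) (auto simp: K_def)
  also have "\<dots> \<le> (\<Sum>i<h. card (K i))" by (rule card_UN_le) simp
  also have "\<dots> \<le> (\<Sum>i<h. 3)"
    by (intro sum_mono card_geom_terms_in_arith_prog_le_3[OF assms]) (auto simp: K_def)
  finally show ?thesis by (simp add: h_def)
qed

theorem theorem1p3:
  shows "(\<exists>C2::real. C2 > 0 \<and>
            (\<forall>q::real. q > 1 \<and> \<not> is_root_of_rational q \<longrightarrow>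
              (\<forall>(u::real) (n::nat). u > 0 \<and> n \<ge> 1 \<longrightarrow>
                 real (ap_cover_number (geom_prog_upto n u q)) \<ge> C2 * real n)))
       \<and> (\<forall>q::real. q > 1 \<and> \<not> is_root_of_rational q \<longrightarrow>
              (\<forall>(u::real) (n::nat). u > 0 \<and> n \<ge> 1 \<longrightarrow>
                 real (ap_cover_number (geom_prog_upto n u q)) \<ge> (1 / 6) * real n))"
proof -
  \<comment> \<open>The constant 1/3 obtained above is better than 1/6, so 1/6 serves for both
    conjuncts.\<close>
  have "real (ap_cover_number (geom_prog_upto n u q)) \<ge> (1 / 6) * real n"
    if "q > 1" "\<not> is_root_of_rational q" "u > 0" for q u n
    using ap_cover_number_geom_prog_ge[OF that, of n] by linarith
  then show ?thesis by (intro conjI exI[of _ "1 / 6"]) auto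
qed

end
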